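(* Let $\Delta_3(n)$ denote the number of broken $3$-diamond partitions of $n$, so that $\sum_{n=0}^{\infty}\Delta_3(n)q^n=\prod_{n=1}^{\infty}\frac{(1-q^{2n})(1-q^{7n})}{(1-q^n)^3(1-q^{14n})}$. Then, as formal power series in $q$ with integer coefficients, $$\prod_{n=1}^\infty(1-q^n)^4(1-q^{2n})^6 \equiv 6\sum_{n=0}^\infty \Delta_3(7n+5)q^n \pmod{7}.$$
   Context: For a positive integer $k$, $\Delta_k(n)$ denotes the number of broken $k$-diamond partitions of $n$ (Andrews and Paule). These numbers are integers determined by the generating function identity $$\sum_{n=0}^{\infty}\Delta_k(n)q^n=\prod_{n=1}^{\infty}\frac{(1-q^{2n})(1-q^{(2k+1)n})}{(1-q^n)^3(1-q^{(4k+2)n})},$$ which may be taken as the definition of $\Delta_k(n)$. For power series $f,g\in\mathbb{Z}[[q]]$ and a positive integer $M$, $f\equiv g \pmod M$ means that for every $n\ge 0$ the coefficients of $q^n$ in $f$ and $g$ are congruent modulo $M$. *)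

theory Defs
  imports "HOL-Analysis.Infinite_Products" "HOL-Computational_Algebra.Formal_Power_Series"
    "HOL-Number_Theory.Cong"
begin

text \<open>Infinite products are products in the library's (\<open>q\<close>-adic) topology on formal power series.
  The index \<open>n\<close> of \<open>prodinf\<close> starts at \<open>0\<close>, hence the shift to \<open>n + 1\<close>.\<close>

definition broken_diamond_factor :: "nat \<Rightarrow> nat \<Rightarrow> rat fps" where
  "broken_diamond_factor k n =
     ((1 - fps_X ^ (2 * n)) * (1 - fps_X ^ ((2 * k + 1) * n))) /
     ((1 - fps_X ^ n) ^ 3 * (1 - fps_X ^ ((4 * k + 2) * n)))"

text \<open>The quotient is formed over the rationals because the library divides power series only over
  fields; the coefficients are integers, and \<open>broken_diamond_gf\<close> below shows that the
  description is satisfied.\<close>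

definition broken_diamond :: "nat \<Rightarrow> nat \<Rightarrow> int" where
  "broken_diamond k =
     (THE D. (\<lambda>n. broken_diamond_factor k (n + 1)) has_prod Abs_fps (\<lambda>n. rat_of_int (D n)))"

definition fps_cong :: "int fps \<Rightarrow> int fps \<Rightarrow> int \<Rightarrow> bool" where
  "fps_cong f g M \<longleftrightarrow> (\<forall>n. [fps_nth f n = fps_nth g n] (mod M))"

lemma fps_mult_agree_one:
  fixes f g :: "'a::comm_ring_1 fps"
  assumes "\<And>k. k \<le> n \<Longrightarrow> fps_nth f k = fps_nth 1 k" "k \<le> n"
  shows "fps_nth (f * g) k = fps_nth g k"
proof -
  have "fps_nth (f * g) k = (\<Sum>i=0..k. fps_nth f i * fps_nth g (k - i))"
    by (rule fps_mult_nth)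
  also have "\<dots> = (\<Sum>i=0..k. fps_nth 1 i * fps_nth g (k - i))"
    by (rule sum.cong) (use assms in auto)
  also have "\<dots> = fps_nth (1 * g) k"
    by (rule fps_mult_nth [symmetric])
  finally show ?thesis by simp
qed

lemma fps_raw_has_prod:
  fixes f :: "nat \<Rightarrow> 'a::idom fps"
  assumes "\<And>n k. k \<le> n \<Longrightarrow> fps_nth (f n) k = fps_nth 1 k"
  shows "raw_has_prod f 0 (Abs_fps (\<lambda>k. fps_nth (\<Prod>i\<le>k. f i) k))"
proof -
  define p where "p = Abs_fps (\<lambda>k. fps_nth (\<Prod>i\<le>k. f i) k)"
  have stable: "fps_nth (\<Prod>i\<le>N. f i) k = fps_nth p k" if "k \<le> N" for k N
    using that
  proof (induction N rule: dec_induct)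
    case base
    show ?case by (simp add: p_def)
  next
    case (step N)
    have "fps_nth (f (Suc N) * (\<Prod>i\<le>N. f i)) k = fps_nth (\<Prod>i\<le>N. f i) k"
      by (rule fps_mult_agree_one [where n = "Suc N"]) (use assms step in auto)
    then show ?case using step.IH by (simp add: mult.commute)
  qed
  have "(\<lambda>N. \<Prod>i\<le>N. f i) \<longlonglongrightarrow> p"
    by (rule tendsto_fpsI) (use stable in \<open>auto intro: eventually_sequentiallyI\<close>)
  moreover have "fps_nth p 0 = 1"
    using assms[of 0 0] by (simp add: p_def)
  then have "p \<noteq> 0" by auto
  ultimately show ?thesis
    unfolding raw_has_prod_def p_def by simp
qed

lemma agree_one_mult:
  fixes f g :: "'a::comm_ring_1 fps"
  assumes "\<forall>k\<le>n. fps_nth f k = fps_nth 1 k" "\<forall>k\<le>n. fps_nth g k = fps_nth 1 k"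
  shows "\<forall>k\<le>n. fps_nth (f * g) k = fps_nth 1 k"
  using fps_mult_agree_one[of n f _ g] assms by simp

lemma agree_one_power:
  fixes f :: "'a::comm_ring_1 fps"
  assumes "\<forall>k\<le>n. fps_nth f k = fps_nth 1 k"
  shows "\<forall>k\<le>n. fps_nth (f ^ m) k = fps_nth 1 k"
proof (induction m)
  case (Suc m)
  show ?case using agree_one_mult[OF assms Suc] by simp
qed simp

lemma agree_one_euler:
  assumes "m > n"
  shows "\<forall>k\<le>n. fps_nth (1 - fps_X ^ m :: 'a::comm_ring_1 fps) k = fps_nth 1 k"
  using assms by (auto simp: fps_X_power_nth)

lemma agree_one_inverse:
  fixes f :: "'a::field fps"
  assumes "\<forall>k\<le>n. fps_nth f k = fps_nth 1 k"
  shows "\<forall>k\<le>n. fps_nth (inverse f) k = fps_nth 1 k"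
proof -
  have "fps_nth f 0 \<noteq> 0" using assms by auto
  then have "f * inverse f = 1" by (simp add: inverse_mult_eq_1')
  then show ?thesis using fps_mult_agree_one[of n f _ "inverse f"] assms by simp
qed

lemma Ints_fps_mult:
  fixes f g :: "'a::comm_ring_1 fps"
  assumes "\<forall>k. fps_nth f k \<in> \<int>" "\<forall>k. fps_nth g k \<in> \<int>"
  shows "\<forall>k. fps_nth (f * g) k \<in> \<int>"
  using assms by (auto simp: fps_mult_nth intro!: Ints_sum Ints_mult)

lemma Ints_fps_power:
  fixes f :: "'a::comm_ring_1 fps"
  assumes "\<forall>k. fps_nth f k \<in> \<int>"
  shows "\<forall>k. fps_nth (f ^ m) k \<in> \<int>"
proof (induction m)
  case (Suc m)
  show ?case using Ints_fps_mult[OF assms Suc] by simp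
qed auto

lemma Ints_fps_prod:
  fixes f :: "'b \<Rightarrow> 'a::comm_ring_1 fps"
  assumes "\<And>i. \<forall>k. fps_nth (f i) k \<in> \<int>"
  shows "\<forall>k. fps_nth (\<Prod>i\<in>A. f i) k \<in> \<int>"
proof (induction A rule: infinite_finite_induct)
  case (insert x A)
  show ?case using Ints_fps_mult[OF assms insert.IH] insert.hyps by simp
qed auto

lemma Ints_fps_inverse:
  fixes f :: "'a::field fps"
  assumes "\<forall>k. fps_nth f k \<in> \<int>" "fps_nth f 0 = 1"
  shows "\<forall>k. fps_nth (inverse f) k \<in> \<int>"
proof
  fix k
  show "fps_nth (inverse f) k \<in> \<int>"
  proof (induction k rule: less_induct)
    case (less k)
    show ?case
    proof (cases "k = 0")
      case False
      have "fps_nth (inverse f) k =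
          - (\<Sum>i=1..k. fps_nth f i * fps_nth (inverse f) (k - i))"
        using False assms(2) by (cases k) (auto simp: fps_inverse_def)
      moreover have "(\<Sum>i=1..k. fps_nth f i * fps_nth (inverse f) (k - i)) \<in> \<int>"
        using less assms(1) by (auto intro!: Ints_sum Ints_mult)
      ultimately show ?thesis by simp
    qed (use assms in simp)
  qed
qed

lemma broken_diamond_factor_altdef:
  assumes "n > 0"
  shows "broken_diamond_factor k n =
     ((1 - fps_X ^ (2 * n)) * (1 - fps_X ^ ((2 * k + 1) * n))) *
     inverse ((1 - fps_X ^ n) ^ 3 * (1 - fps_X ^ ((4 * k + 2) * n)))"
  unfolding broken_diamond_factor_def
  by (rule fps_divide_unit) (use assms in \<open>simp add: fps_nth_power_0 power_0_left\<close>)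

lemma agree_one_broken_diamond_factor:
  "\<forall>j\<le>n. fps_nth (broken_diamond_factor k (n + 1)) j = fps_nth 1 j"
proof -
  have "n < (2 * k + 1) * (n + 1)" "n < (4 * k + 2) * (n + 1)"
    by (simp_all add: algebra_simps)
  then show ?thesis
    by (subst broken_diamond_factor_altdef, simp)
       (intro agree_one_mult agree_one_inverse agree_one_power agree_one_euler, simp_all)
qed

lemma Ints_broken_diamond_factor:
  "\<forall>j. fps_nth (broken_diamond_factor k (n + 1)) j \<in> \<int>"
proof -
  have e: "\<forall>j. fps_nth (1 - fps_X ^ m :: rat fps) j \<in> \<int>" for m
    by (auto simp: fps_X_power_nth)
  show ?thesis
    by (subst broken_diamond_factor_altdef, simp)
       (intro Ints_fps_mult Ints_fps_inverse Ints_fps_power e, simp add: fps_nth_power_0 power_0_left)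
qed

theorem broken_diamond_gf:
  "(\<lambda>n. broken_diamond_factor k (n + 1)) has_prod
     Abs_fps (\<lambda>n. rat_of_int (broken_diamond k n))"
proof -
  let ?f = "\<lambda>n. broken_diamond_factor k (n + 1)"
  define D where "D = (\<lambda>j. \<lfloor>fps_nth (\<Prod>i\<le>j. ?f i) j\<rfloor>)"
  have "rat_of_int (D j) = fps_nth (\<Prod>i\<le>j. ?f i) j" for j
    unfolding D_def using Ints_fps_prod[of ?f "{..j}", OF Ints_broken_diamond_factor]
    by (intro of_int_floor) simp
  moreover have "?f has_prod Abs_fps (\<lambda>j. fps_nth (\<Prod>i\<le>j. ?f i) j)"
    unfolding has_prod_def by (intro disjI1 fps_raw_has_prod) (rule agree_one_broken_diamond_factor [rule_format])
  ultimately have D: "?f has_prod Abs_fps (\<lambda>j. rat_of_int (D j))" by simp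
  have "E = D" if "?f has_prod Abs_fps (\<lambda>n. rat_of_int (E n))" for E
    using has_prod_unique2 [OF that D] by (auto simp: fps_eq_iff)
  with D have "broken_diamond k = D"
    unfolding broken_diamond_def by (intro the_equality)
  with D show ?thesis by simp
qed

lemma convergent_prod_euler_4_6:
  "convergent_prod (\<lambda>n. (1 - fps_X ^ (n + 1)) ^ 4 * (1 - fps_X ^ (2 * (n + 1))) ^ 6 :: int fps)"
proof -
  have agree: "\<forall>j\<le>n. fps_nth ((1 - fps_X ^ (n + 1)) ^ 4 * (1 - fps_X ^ (2 * (n + 1))) ^ 6 :: int fps) j
      = fps_nth 1 j" for n
    by (intro agree_one_mult agree_one_power agree_one_euler) simp_all
  have "raw_has_prod
      (\<lambda>n. (1 - fps_X ^ (n + 1)) ^ 4 * (1 - fps_X ^ (2 * (n + 1))) ^ 6 :: int fps) 0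
      (Abs_fps (\<lambda>k. fps_nth
        (\<Prod>n\<le>k. (1 - fps_X ^ (n + 1)) ^ 4 * (1 - fps_X ^ (2 * (n + 1))) ^ 6) k))"
    by (intro fps_raw_has_prod) (rule agree [rule_format])
  then show ?thesis
    unfolding convergent_prod_def by blast
qed

end

theory Submission
  imports Defs "HOL-Computational_Algebra.Nth_Powers"
begin

text \<open>
  Work over the field with seven elements, let \<open>E\<^sub>m\<close> be the product of all \<open>1 - q ^ (m * n)\<close>,
  and let \<open>\<theta> = q * d/dq\<close>. By Frobenius \<open>E\<^sub>7 = E\<^sub>1 ^ 7\<close>, so the generating function of
  \<open>\<Delta>\<^sub>3\<close> is \<open>E\<^sub>1 ^ 4 / E\<^sub>2 ^ 6\<close>, and \<open>q\<^sup>2\<close> times it times \<open>E\<^sub>1\<^sub>4 ^ 4\<close> (a series in \<open>q ^ 14\<close>)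
  is \<open>g = z * M\<^sup>2\<close>, where \<open>z\<close> is the square of the theta series of \<open>(-1) ^ n * q ^ n\<^sup>2\<close>
  and \<open>M = q * E\<^sub>2 ^ 12\<close>. The claim follows from \<open>\<theta> ^ 6 g = g + (z * M) ^ 7\<close>: since \<open>\<theta> ^ 6\<close>
  kills the coefficients with index divisible by 7, those of \<open>g\<close> are minus those of the
  series \<open>z * M\<close>.

  For the differential equation, let \<open>y\<close> be the square of the theta series of \<open>q ^ n\<^sup>2\<close>. The
  substitution \<open>q \<mapsto> q\<^sup>2\<close> acts on \<open>(y, z)\<close> as the arithmetic-geometric mean step. A series
  is often determined by such a functional equation and its first coefficients, which gives the
  logarithmic derivatives of \<open>y\<close> and \<open>z\<close>, the formula for \<open>M\<close>, and the cubic relation between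
  \<open>y\<^sup>2\<close> and \<open>z\<^sup>2\<close> (the Eisenstein series of weight 6 is 1 modulo 7).
\<close>

\<comment> \<open>The field with seven elements\<close>
quotient_type f7 = int / "\<lambda>a b :: int. a mod 7 = b mod 7"
  by (intro equivpI reflpI sympI transpI) auto

instantiation f7 :: field
begin

lift_definition zero_f7 :: f7 is "0" .
lift_definition one_f7 :: f7 is "1" .
lift_definition plus_f7 :: "f7 \<Rightarrow> f7 \<Rightarrow> f7" is "(+)"
  by (metis mod_add_cong)
lift_definition minus_f7 :: "f7 \<Rightarrow> f7 \<Rightarrow> f7" is "(-)"
  by (metis mod_diff_cong)
lift_definition uminus_f7 :: "f7 \<Rightarrow> f7" is "uminus"
  by (metis mod_minus_cong)
lift_definition times_f7 :: "f7 \<Rightarrow> f7 \<Rightarrow> f7" is "(*)"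
  by (metis mod_mult_cong)
text \<open>Fermat: the inverse of \<open>a\<close> modulo 7 is \<open>a\<^sup>5\<close>, also for the convention \<open>0\<close> at \<open>0\<close>.\<close>
lift_definition inverse_f7 :: "f7 \<Rightarrow> f7" is "\<lambda>a. a ^ 5"
  by (metis power_mod)
definition divide_f7 :: "f7 \<Rightarrow> f7 \<Rightarrow> f7" where "divide_f7 a b = a * inverse b"

instance
proof
  fix a :: f7
  show "inverse a * a = 1" if "a \<noteq> 0"
    using that
  proof (transfer, goal_cases)
    case (1 a)
    then have "a mod 7 \<in> {1,2,3,4,5,6}"
      using pos_mod_sign[of 7 a] pos_mod_bound[of 7 a] by auto
    then have "((a mod 7) ^ 6) mod 7 = 1" by (elim insertE) auto
    then have "a ^ 6 mod 7 = 1" by (simp add: power_mod)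
    then show ?case by (simp add: eval_nat_numeral mult_ac)
  qed
qed (transfer; simp add: algebra_simps divide_f7_def)+
 
end

lemma of_int_f7: "of_int n = abs_f7 n"
proof -
  have "of_nat k = abs_f7 (int k)" for k
    by (induction k) (simp_all add: zero_f7.abs_eq one_f7.abs_eq plus_f7.abs_eq)
  then show ?thesis
    by (cases n rule: int_cases2) (simp_all add: uminus_f7.abs_eq)
qed

lemma of_int_f7_eq_iff: "(of_int a :: f7) = of_int b \<longleftrightarrow> [a = b] (mod 7)"
  by (simp add: of_int_f7 f7.abs_eq_iff cong_def)

lemma f7_seven: "(7 :: f7) = 0"
  using of_int_f7_eq_iff[of 7 0] by (simp add: cong_def)

lemma f7_fermat: "(a :: f7) ^ 7 = a"
proof (cases "a = 0")
  case False
  have "inverse a = a ^ 5"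
    by (transfer)  simp
  with False have "a ^ 5 * a = 1" by (metis left_inverse)
  then show ?thesis by (simp add: eval_nat_numeral mult_ac)
qed simp

lemma CHAR_f7: "CHAR(f7) = 7"
proof (rule CHAR_eqI)
  show "of_nat 7 = (0 :: f7)" using f7_seven by simp
  show "7 dvd n" if "of_nat n = (0 :: f7)" for n
    using of_int_f7_eq_iff[of "int n" 0] that by (simp add: cong_0_iff) presburger
qed

subsection \<open>Formal power series\<close>

definition fps_subst_power :: "nat \<Rightarrow> 'a::idom fps \<Rightarrow> 'a fps" where
  "fps_subst_power m f = f oo fps_X ^ m"

lemma fps_subst_power_nth:
  assumes "m > 0"
  shows "fps_nth (fps_subst_power m f) n = (if m dvd n then fps_nth f (n div m) else 0)"
proof -
  have "fps_nth (fps_subst_power m f) n = (\<Sum>i=0..n. if n = m * i then fps_nth f i else 0)"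
    by (simp add: fps_subst_power_def fps_compose_nth fps_X_power_nth if_distrib cong: if_cong flip: power_mult)
  also have "\<dots> = (\<Sum>i\<in>{i\<in>{0..n}. n = m * i}. fps_nth f i)"
    by (rule sum.inter_filter [symmetric]) simp
  also have "\<dots> = (if m dvd n then fps_nth f (n div m) else 0)"
  proof (cases "m dvd n")
    case True
    with assms have "{i\<in>{0..n}. n = m * i} = {n div m}" by auto
    with True show ?thesis by simp
  next
    case False
    then have "{i\<in>{0..n}. n = m * i} = {}" by auto
    with False show ?thesis by (simp only: sum.empty if_False)
  qed
  finally show ?thesis .
qed

context
  fixes m :: nat
  assumes m: "m > 0"
begin

lemma fps_subst_power_simps [simp]:
  "fps_subst_power m (f + g) = fps_subst_power m f + fps_subst_power m g"
  "fps_subst_power m (f - g) = fps_subst_power m f - fps_subst_power m g"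
  "fps_subst_power m (- f) = - fps_subst_power m f"
  "fps_subst_power m (f * g) = fps_subst_power m f * fps_subst_power m g"
  "fps_subst_power m (f ^ k) = fps_subst_power m f ^ k"
  "fps_subst_power m 0 = 0"
  "fps_subst_power m 1 = 1"
  "fps_subst_power m (numeral b) = numeral b"
  "fps_subst_power m fps_X = fps_X ^ m"
  "fps_subst_power m (\<Prod>i\<in>A. h i) = (\<Prod>i\<in>A. fps_subst_power m (h i))"
  using m
  by (simp_all add: fps_subst_power_def fps_compose_add_distrib fps_compose_sub_distrib
      fps_compose_uminus fps_compose_mult_distrib fps_compose_prod_distrib numeral_fps_const flip: fps_compose_power)

lemma fps_subst_power_fps_subst_power:
  assumes "k > 0"
  shows "fps_subst_power k (fps_subst_power m f) = fps_subst_power (k * m) f"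
proof (rule fps_ext)
  fix n
  have "k * m dvd n \<longleftrightarrow> k dvd n \<and> m dvd n div k"
    using assms by (auto simp: dvd_div_iff_mult mult.commute intro: dvd_mult_left)
  then show "fps_nth (fps_subst_power k (fps_subst_power m f)) n = fps_nth (fps_subst_power (k * m) f) n"
    using assms m by (auto simp: fps_subst_power_nth div_mult2_eq)
qed

lemma tendsto_fps_subst_power:
  assumes "f \<longlonglongrightarrow> F"
  shows "(\<lambda>n. fps_subst_power m (f n)) \<longlonglongrightarrow> fps_subst_power m F"
proof (rule tendsto_fpsI)
  fix n
  have "\<forall>\<^sub>F x in sequentially. fps_nth (f x) (n div m) = fps_nth F (n div m)"
    using assms by (auto simp: tendsto_fps_iff)
  then show "\<forall>\<^sub>F x in sequentially. fps_nth (fps_subst_power m (f x)) n = fps_nth (fps_subst_power m F) n"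
    by eventually_elim (use m in \<open>simp add: fps_subst_power_nth\<close>)
qed

end

lemma tendsto_mult_fps:
  fixes f g :: "'b \<Rightarrow> 'a::comm_ring_1 fps"
  assumes "(f \<longlongrightarrow> F) L" "(g \<longlongrightarrow> G) L"
  shows "((\<lambda>x. f x * g x) \<longlongrightarrow> F * G) L"
proof (rule tendsto_fpsI)
  fix n
  have "\<forall>\<^sub>F x in L. \<forall>i\<in>{0..n}. fps_nth (f x) i = fps_nth F i"
    "\<forall>\<^sub>F x in L. \<forall>i\<in>{0..n}. fps_nth (g x) i = fps_nth G i"
    using assms by (auto simp: tendsto_fps_iff eventually_ball_finite_distrib)
  then show "\<forall>\<^sub>F x in L. fps_nth (f x * g x) n = fps_nth (F * G) n"
    by eventually_elim (simp add: fps_mult_nth)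
qed

lemma tendsto_power_fps:
  fixes f :: "'b \<Rightarrow> 'a::comm_ring_1 fps"
  assumes "(f \<longlongrightarrow> F) L"
  shows "((\<lambda>x. f x ^ k) \<longlongrightarrow> F ^ k) L"
  by (induction k) (simp_all add: tendsto_mult_fps assms)

text \<open>The factor with index \<open>n\<close> differs from 1 only above order \<open>n\<close>,
  so the coefficient of index \<open>k\<close> is final after \<open>Suc k\<close> factors.\<close>

lemma tendsto_fps_prod:
  fixes f :: "nat \<Rightarrow> 'a::comm_ring_1 fps"
  assumes "\<And>n k. k \<le> n \<Longrightarrow> fps_nth (f n) k = fps_nth 1 k"
  shows "(\<lambda>N. \<Prod>i<N. f i) \<longlonglongrightarrow> Abs_fps (\<lambda>k. fps_nth (\<Prod>i<Suc k. f i) k)"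
proof (rule tendsto_fpsI)
  fix k
  have "fps_nth (\<Prod>i<N. f i) k = fps_nth (\<Prod>i<Suc k. f i) k" if "Suc k \<le> N" for N
    using that
  proof (induction N rule: dec_induct)
    case (step N)
    have "fps_nth (f N * (\<Prod>i<N. f i)) k = fps_nth (\<Prod>i<N. f i) k"
      by (rule fps_mult_agree_one [where n = N]) (use assms step in auto)
    then show ?case using step.IH by (simp add: mult.commute)
  qed simp
  then show "\<forall>\<^sub>F N in sequentially. fps_nth (\<Prod>i<N. f i) k = fps_nth (Abs_fps (\<lambda>k. fps_nth (\<Prod>i<Suc k. f i) k)) k"
    by (auto intro: eventually_sequentiallyI)
qed

text \<open>Uniqueness principle, applied below to differences of two solutions. A nonzero
  \<open>f\<close> of order \<open>d > n\<close> gives a left side of order at most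
  \<open>n + d < 2 * d\<close>, but the substitution doubles orders, so the right side vanishes
  below \<open>2 * d\<close>.\<close>

lemma fps_subst_power_2_eq_0:
  fixes f :: "'a::idom fps"
  assumes "v * f = u * fps_subst_power 2 f" "fps_nth v n \<noteq> 0" "\<And>i. i \<le> n \<Longrightarrow> fps_nth f i = 0"
  shows "f = 0"
proof (rule ccontr)
  assume "f \<noteq> 0"
  have v: "v \<noteq> 0" "subdegree v \<le> n" using assms(2) by (auto intro: subdegree_leI)
  have f: "subdegree f > n" using \<open>f \<noteq> 0\<close> assms(3) by (intro subdegree_greaterI) auto
  have "subdegree (v * f) < subdegree f + subdegree f"
    using v f \<open>f \<noteq> 0\<close> by simp
  moreover have "fps_nth (u * fps_subst_power 2 f) k = 0" if "k < 2 * subdegree f" for k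
  proof -
    have "fps_nth u i * fps_nth (fps_subst_power 2 f) (k - i) = 0" if "i \<le> k" for i
      using \<open>k < 2 * subdegree f\<close> by (auto simp: fps_subst_power_nth nth_less_subdegree_zero)
    then show ?thesis unfolding fps_mult_nth by (intro sum.neutral) auto
  qed
  moreover have "fps_nth (v * f) (subdegree (v * f)) \<noteq> 0"
    using v \<open>f \<noteq> 0\<close> by (intro nth_subdegree_nonzero) simp
  ultimately show False using assms(1) by (metis mult_2)
qed

section \<open>The derivation \<open>q * d/dq\<close> and the Frobenius map\<close>

definition theta :: "'a::idom fps \<Rightarrow> 'a fps" where
  "theta f = fps_X * fps_deriv f"

lemma theta_nth: "fps_nth (theta f) n = of_nat n * fps_nth f n"
  by (cases n) (simp_all add: theta_def)

lemma theta_simps [simp]: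
  "theta (f + g) = theta f + theta g"
  "theta (f - g) = theta f - theta g"
  "theta (- f) = - theta f"
  "theta (numeral b) = 0"
  "theta 1 = 0"
  "theta fps_X = fps_X"
  "theta (f * g) = theta f * g + f * theta g"
  by (simp_all add: theta_def algebra_simps)

lemma theta_power: "theta (f ^ k) = of_nat k * f ^ (k - 1) * theta f"
  by (induction k) (auto simp: algebra_simps power_eq_if)

lemma theta_fps_subst_power:
  assumes "m > 0"
  shows "theta (fps_subst_power m f) = of_nat m * fps_subst_power m (theta f)"
  using assms by (auto simp: fps_eq_iff theta_nth fps_subst_power_nth fps_of_nat [symmetric])

lemma fps_f7_seven: "(7 :: f7 fps) = 0"
  by (simp add: numeral_fps_const f7_seven)

text \<open>Frobenius, with Fermat for the coefficients. The freshman's dream needs finite sums, so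
  \<open>f\<close> is cut off after index \<open>n\<close>; the seventh power of the tail starts
  beyond \<open>n\<close>.\<close>

lemma fps_f7_power_7: "f ^ 7 = fps_subst_power 7 (f :: f7 fps)"
proof (rule fps_ext)
  fix n
  let ?c = "fps_cutoff (Suc n) f"
  have frob: "(x + y) ^ 7 = x ^ 7 + y ^ 7" for x y :: "f7 fps"
    by (rule freshmans_dream) (simp_all add: CHAR_f7)
  have "f = ?c + fps_X ^ Suc n * fps_shift (Suc n) f"
    by (metis fps_shift_cutoff' add.commute)
  then have "f ^ 7 = ?c ^ 7 + (fps_X ^ Suc n * fps_shift (Suc n) f) ^ 7"
    using frob by metis
  then have "fps_nth (f ^ 7) n = fps_nth (?c ^ 7) n"
    by (simp add: power_mult_distrib fps_X_power_mult_nth flip: power_mult del: power_Suc)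
  also have "?c = (\<Sum>i\<le>n. fps_const (fps_nth f i) * fps_X ^ i)"
    by (auto simp: fps_eq_iff fps_sum_nth fps_X_power_nth if_distrib cong: if_cong)
  also have "\<dots> ^ 7 = (\<Sum>i\<le>n. (fps_const (fps_nth f i) * fps_X ^ i) ^ 7)"
    by (rule freshmans_dream_sum) (simp_all add: CHAR_f7)
  also have "\<dots> = (\<Sum>i\<le>n. fps_const (fps_nth f i) * fps_X ^ (7 * i))"
    by (intro sum.cong) (simp_all add: power_mult_distrib fps_const_power f7_fermat mult.commute flip: power_mult)
  also have "fps_nth \<dots> n = fps_nth (fps_subst_power 7 f) n"
    by (simp add: fps_subst_power_def fps_compose_nth fps_sum_nth atLeast0AtMost flip: power_mult)
  finally show "fps_nth (f ^ 7) n = fps_nth (fps_subst_power 7 f) n" .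
qed

subsection \<open>Theta series and their products\<close>

text \<open>A coefficientwise definition from finite products makes sense over every domain and
  commutes with the passage between \<open>int\<close>, \<open>rat\<close> and
  \<open>f7\<close>.\<close>

definition euler :: "'a::idom fps" where
  "euler = Abs_fps (\<lambda>k. fps_nth (\<Prod>i<Suc k. 1 - fps_X ^ (i + 1)) k)"

definition euler_odd :: "'a::idom fps" where
  "euler_odd = Abs_fps (\<lambda>k. fps_nth (\<Prod>i<Suc k. 1 - fps_X ^ (2 * i + 1)) k)"

lemma tendsto_euler: "(\<lambda>N. \<Prod>i<N. 1 - fps_X ^ (i + 1)) \<longlonglongrightarrow> (euler :: 'a::idom fps)"
  unfolding euler_def by (rule tendsto_fps_prod) (use agree_one_euler in force)

lemma tendsto_euler_odd: "(\<lambda>N. \<Prod>i<N. 1 - fps_X ^ (2 * i + 1)) \<longlonglongrightarrow> (euler_odd :: 'a::idom fps)"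
  unfolding euler_odd_def by (rule tendsto_fps_prod) (use agree_one_euler in force)

lemma tendsto_euler_subst:
  assumes "m > 0"
  shows "(\<lambda>N. \<Prod>i<N. 1 - fps_X ^ (m * (i + 1))) \<longlonglongrightarrow> (fps_subst_power m euler :: 'a::idom fps)"
  using tendsto_fps_subst_power [OF assms tendsto_euler [where 'a='a]] assms
  by (simp add: mult.commute flip: power_mult power_Suc)

lemma euler_nth_0 [simp]: "fps_nth euler 0 = 1"
  by (simp add: euler_def)

text \<open>Split the first \<open>2 * N\<close> factors by the parity of the exponent.\<close>

lemma euler_factor: "euler = euler_odd * fps_subst_power 2 (euler :: 'a::idom fps)"
proof (rule LIMSEQ_unique)
  have *: "(\<Prod>i<2 * N. 1 - fps_X ^ (i + 1)) =
      (\<Prod>i<N. 1 - fps_X ^ (2 * i + 1)) * (\<Prod>i<N. 1 - fps_X ^ (2 * (i + 1)) :: 'a fps)" for N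
    by (induction N) (simp_all add: mult_ac)
  show "(\<lambda>N. \<Prod>i<2 * N. 1 - fps_X ^ (i + 1)) \<longlonglongrightarrow>
      euler_odd * fps_subst_power 2 (euler :: 'a fps)"
    unfolding * by (intro tendsto_mult_fps tendsto_euler_odd tendsto_euler_subst) simp
  have "strict_mono (\<lambda>N :: nat. 2 * N)" by (auto simp: strict_mono_def)
  from LIMSEQ_subseq_LIMSEQ [OF tendsto_euler this]
  show "(\<lambda>N. \<Prod>i<2 * N. 1 - fps_X ^ (i + 1)) \<longlonglongrightarrow> (euler :: 'a fps)" by (simp add: o_def)
qed

text \<open>Shanks' finite form of Gauss's product for the theta series.\<close>

lemma shanks_identity:
  fixes q :: "'a::comm_ring_1" and u :: "nat \<Rightarrow> 'a"
  assumes u: "\<And>k. k > 0 \<Longrightarrow> u k * (1 + q ^ k) = 1"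
  defines "R \<equiv> \<lambda>n s. \<Prod>k\<in>{s<..n}. (1 - q ^ k) * u k"
  shows "1 + 2 * (\<Sum>s=1..n. (-1) ^ s * q ^ s\<^sup>2) =
    R n 0 + 2 * (\<Sum>s=1..n. (-1) ^ s * (R n s * u s * q ^ (s * Suc n)))"
proof (induction n)
  case 0
  show ?case by (simp add: R_def)
next
  case (Suc n)
  let ?N = "Suc n"
  \<comment> \<open>From \<open>n\<close> to \<open>?N\<close>, the term of index \<open>s\<close>
    drops by \<open>u ?N * (U (s - 1) + U s)\<close>; with alternating signs these changes
    telescope.\<close>
  define U where "U = (\<lambda>s. R n s * q ^ (Suc s * ?N))"
  have R_Suc: "R ?N s = R n s * ((1 - q ^ ?N) * u ?N)" if "s \<le> n" for s
  proof -
    have "{s<..?N} = insert ?N {s<..n}" using that by auto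
    then show ?thesis by (simp add: R_def mult_ac)
  qed
  have R_pred: "R n (s - 1) = (1 - q ^ s) * u s * R n s" if "s \<in> {1..n}" for s
  proof -
    have "{s - 1<..n} = insert s {s<..n}" using that by auto
    then show ?thesis by (simp add: R_def)
  qed
  have step: "R ?N s * u s * q ^ (s * Suc ?N) = R n s * u s * q ^ (s * ?N) - u ?N * (U (s - 1) + U s)"
    if s: "s \<in> {1..n}" for s
  proof -
    have us: "u s * (1 + q ^ s) = 1" and uN: "u ?N * (1 + q ^ ?N) = 1"
      using u [of s] u [of ?N] s by auto
    have e1: "U (s - 1) = (1 - q ^ s) * u s * R n s * q ^ (s * ?N)"
      using s R_pred [OF s] by (simp add: U_def del: mult_Suc mult_Suc_right)
    have e2: "U s = R n s * (q ^ (s * ?N) * q ^ ?N)"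
      by (simp add: U_def power_add ac_simps del: mult_Suc_right mult_Suc) (simp add: algebra_simps power_add)
    have e3: "R ?N s * u s * q ^ (s * Suc ?N) =
        R n s * ((1 - q ^ ?N) * u ?N) * u s * (q ^ (s * ?N) * q ^ s)"
      using s by (simp add: R_Suc add.commute flip: power_add del: power_Suc)
    have "r * ((1 - Q) * v) * w * (x * y) = r * w * x - v * ((1 - y) * w * r * x + r * (x * Q))"
      if "w * (1 + y) = 1" "v * (1 + Q) = 1" for r Q v w x y :: 'a
    proof -
      have "r * ((1 - Q) * v) * w * (x * y) = r * w * x * (v * (1 + Q)) - v * ((1 - y) * w * r * x + r * (x * Q) * (w * (1 + y)))"
        by (simp add: algebra_simps)
      then show ?thesis using that by simp
    qed
    from this [OF us uN] show ?thesis unfolding e3 e1 e2 .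
  qed
  have tele: "(\<Sum>s=1..k. (-1) ^ s * (U (s - 1) + U s)) = (-1) ^ k * U k - U 0" for k
    by (induction k) (simp_all add: algebra_simps)
  have "(\<Sum>s=1..n. (-1) ^ s * (R ?N s * u s * q ^ (s * Suc ?N))) =
      (\<Sum>s=1..n. (-1) ^ s * (R n s * u s * q ^ (s * ?N)) - u ?N * ((-1) ^ s * (U (s - 1) + U s)))"
    by (intro sum.cong refl) (simp only: step right_diff_distrib mult.left_commute)
  also have "\<dots> = (\<Sum>s=1..n. (-1) ^ s * (R n s * u s * q ^ (s * ?N))) - u ?N * ((-1) ^ n * U n - U 0)"
    unfolding tele [symmetric] by (simp only: sum_subtractf sum_distrib_left)
  finally have sum_n: "(\<Sum>s=1..n. (-1) ^ s * (R ?N s * u s * q ^ (s * Suc ?N))) = \<dots>" .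
  have U0: "U 0 = R n 0 * q ^ ?N" by (simp add: U_def)
  have Un: "U n = q ^ ?N\<^sup>2" by (simp add: U_def R_def power2_eq_square)
  have last: "R ?N ?N * u ?N * q ^ (?N * Suc ?N) = u ?N * q ^ ?N\<^sup>2 * q ^ ?N"
    by (simp add: R_def power2_eq_square algebra_simps power_add)
  have uN: "u ?N * (1 + q ^ ?N) = 1" by (rule u) simp
  \<comment> \<open>To be read with \<open>r = R n 0\<close>, \<open>S\<close> the old sum,
    \<open>Q = q ^ ?N\<close>, \<open>v = u ?N\<close>, \<open>e = (-1) ^ n\<close> and
    \<open>y = q ^ ?N\<^sup>2\<close>.\<close>
  have fin: "r + 2 * S + 2 * (- e * y) = r * ((1 - Q) * v) + 2 * ((S - v * (e * y - r * Q)) + - e * (v * y * Q))"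
    if v: "v * (1 + Q) = 1" for r S e y Q v :: 'a
  proof -
    have "r * ((1 - Q) * v) + 2 * ((S - v * (e * y - r * Q)) + - e * (v * y * Q)) =
      r * (v * (1 + Q)) + 2 * S + 2 * (- e * y) * (v * (1 + Q))"
      by (simp add: algebra_simps)
    then show ?thesis using v by simp
  qed
  have sgn: "(-1) ^ ?N = - ((-1) ^ n :: 'a)" by simp
  have sumS: "(\<Sum>s=1..?N. h s) = (\<Sum>s=1..n. h s) + h ?N" for h :: "nat \<Rightarrow> 'a" by simp
  have "1 + 2 * (\<Sum>s=1..?N. (-1) ^ s * q ^ s\<^sup>2) =
      R n 0 + 2 * (\<Sum>s=1..n. (-1) ^ s * (R n s * u s * q ^ (s * ?N))) + 2 * (- ((-1) ^ n) * q ^ ?N\<^sup>2)"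
    unfolding Suc.IH [symmetric] by (simp add: algebra_simps)
  also have "\<dots> = R ?N 0 + 2 * (\<Sum>s=1..?N. (-1) ^ s * (R ?N s * u s * q ^ (s * Suc ?N)))"
    unfolding sumS sum_n U0 Un last R_Suc [OF le0] sgn by (rule fin [OF uN])
  finally show ?case .
qed

text \<open>The sum of \<open>q ^ n\<^sup>2\<close> over all integers \<open>n\<close>: a nonzero
  square arises from \<open>n\<close> and from \<open>-n\<close>.\<close>

definition theta3 :: "'a::comm_ring_1 fps" where
  "theta3 = Abs_fps (\<lambda>k. if k = 0 then 1 else if is_square k then 2 else 0)"

definition theta4 :: "'a::comm_ring_1 fps" where
  "theta4 = theta3 oo (- fps_X)"

lemma theta4_nth: "fps_nth theta4 k = (-1) ^ k * fps_nth theta3 k"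
  by (simp add: theta4_def fps_compose_uminus')

text \<open>The odd squares cancel and the even ones double; an even square is 4 times a
  square.\<close>

lemma theta3_plus_theta4: "theta3 + theta4 = 2 * fps_subst_power 4 (theta3 :: 'a::idom fps)"
proof (rule fps_ext)
  fix k
  have sq: "is_square k \<longleftrightarrow> 4 dvd k \<and> is_square (k div 4)" if "even k" for k :: nat
  proof
    assume "is_square k"
    then obtain r where r: "k = r ^ 2" by (auto elim: is_nth_powerE)
    with that obtain t where "r = 2 * t" by auto
    with r have "k = 4 * t ^ 2" by (simp add: power2_eq_square)
    then show "4 dvd k \<and> is_square (k div 4)" by simp
  next
    assume *: "4 dvd k \<and> is_square (k div 4)"
    then obtain r where "k div 4 = r ^ 2" by (auto elim: is_nth_powerE)
    with * have "k = (2 * r) ^ 2" by (auto simp: power_mult_distrib)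
    then show "is_square k" by (rule is_nth_powerI)
  qed
  show "fps_nth (theta3 + theta4) k = fps_nth (2 * fps_subst_power 4 (theta3 :: 'a fps)) k"
  proof (cases "4 dvd k")
    case True
    then have "even k" by presburger
    with True show ?thesis
      using sq [of k] dvd_div_eq_0_iff [of 4 k]
      by (simp add: theta4_nth fps_subst_power_nth theta3_def numeral_fps_const)
  next
    case False
    then show ?thesis
      using sq [of k]
      by (cases "even k") (auto simp: theta4_nth fps_subst_power_nth theta3_def numeral_fps_const)
  qed
qed

text \<open>In Shanks' identity at \<open>q = fps_X\<close> all terms of the right-hand sum have
  order above \<open>n\<close>, so \<open>R n 0\<close> tends to \<open>theta4\<close>. Multiplying
  by \<open>1 - q ^ (2 * k)\<close> clears each denominator \<open>1 + q ^ k\<close> and leaves a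
  square.\<close>

lemma theta4_mult_euler:
  "theta4 * fps_subst_power 2 euler = (euler :: 'a::field fps) ^ 2"
proof (rule LIMSEQ_unique)
  define u :: "nat \<Rightarrow> 'a fps" where "u = (\<lambda>k. inverse (1 + fps_X ^ k))"
  define R where "R = (\<lambda>n s. \<Prod>k\<in>{s<..n}. (1 - fps_X ^ k) * u k)"
  have u: "u k * (1 + fps_X ^ k) = 1" if "k > 0" for k
    unfolding u_def using that by (intro inverse_mult_eq_1) (simp add: power_0_left)
  have "(\<lambda>n. R n 0) \<longlonglongrightarrow> theta4"
  proof (rule tendsto_fpsI, rule eventually_sequentiallyI)
    fix k n :: nat assume "k \<le> n"
    have "fps_nth (2 * (\<Sum>s=1..n. (-1) ^ s * (R n s * u s * fps_X ^ (s * Suc n)))) k = 0"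
    proof -
      have "k < s * Suc n" if "s \<in> {1..n}" for s
        using that \<open>k \<le> n\<close> by (cases s) auto
      then have "fps_nth ((-1) ^ s * (R n s * u s * fps_X ^ (s * Suc n))) k = 0" if "s \<in> {1..n}" for s
        using that fps_X_power_mult_right_nth [of "(-1) ^ s * (R n s * u s)" "s * Suc n" k]
        by (simp add: mult.assoc del: mult_Suc_right)
      then show ?thesis by (simp add: numeral_fps_const fps_sum_nth del: mult_Suc_right)
    qed
    with shanks_identity [of u fps_X n, OF u]
    have "fps_nth (R n 0) k = fps_nth (1 + 2 * (\<Sum>s=1..n. (-1) ^ s * fps_X ^ s\<^sup>2)) k"
      by (simp add: R_def)
    also have "\<dots> = (if k = 0 then 1 else 0) + 2 * (\<Sum>s=1..n. if s\<^sup>2 = k then (-1) ^ k else 0)"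
    proof -
      have sgn: "fps_nth ((-1) ^ s * fps_X ^ s\<^sup>2) k = (if s\<^sup>2 = k then (-1) ^ k else 0 :: 'a)" for s
      proof -
        have "(-1) ^ s = fps_const ((-1) ^ s :: 'a)" by (induction s) (simp_all flip: fps_const_neg fps_const_mult)
        then have "fps_nth ((-1) ^ s * fps_X ^ s\<^sup>2) k = ((-1) ^ s * (if k = s\<^sup>2 then 1 else 0) :: 'a)"
          by (simp add: fps_X_power_nth)
        then show ?thesis by (auto simp: power2_eq_square minus_one_power_iff)
      qed
      show ?thesis by (simp add: numeral_fps_const fps_sum_nth sgn)
    qed
    also have "\<dots> = fps_nth theta4 k"
    proof (cases "k > 0 \<and> is_square k")
      case True
      then obtain r where r: "k = r\<^sup>2" by (auto elim: is_nth_powerE)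
      have "(\<Sum>s=1..n. if s\<^sup>2 = k then (-1) ^ k else 0 :: 'a) = (\<Sum>s\<in>{r}. (-1) ^ k)"
      proof (rule sum.mono_neutral_cong_right)
        have "r \<le> r\<^sup>2" by (simp add: power2_eq_square)
        then show "{r} \<subseteq> {1..n}" using True r \<open>k \<le> n\<close> by (auto simp: Suc_le_eq)
      qed (auto simp: r)
      with True show ?thesis by (simp add: theta4_nth theta3_def)
    next
      case False
      then have "(\<Sum>s=1..n. if s\<^sup>2 = k then (-1) ^ k else 0 :: 'a) = 0"
        by (intro sum.neutral) auto
      with False show ?thesis by (auto simp: theta4_nth theta3_def)
    qed
    finally show "fps_nth (R n 0) k = fps_nth theta4 k" .
  qed
  then show "(\<lambda>n. R n 0 * (\<Prod>i<n. 1 - fps_X ^ (2 * (i + 1)))) \<longlonglongrightarrow> theta4 * fps_subst_power 2 euler"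
    by (intro tendsto_mult_fps tendsto_euler_subst) auto
  have "R n 0 * (\<Prod>i<n. 1 - fps_X ^ (2 * (i + 1))) = (\<Prod>i<n. 1 - fps_X ^ (i + 1)) ^ 2" for n
  proof (induction n)
    case 0
    show ?case by (simp add: R_def)
  next
    case (Suc n)
    have "R (Suc n) 0 = R n 0 * ((1 - fps_X ^ Suc n) * u (Suc n))"
    proof -
      have "{0<..Suc n} = insert (Suc n) {0<..n}" by auto
      then show ?thesis by (simp add: R_def mult_ac)
    qed
    moreover have "(1 - Q) * v * (1 - Q\<^sup>2) = (1 - Q)\<^sup>2" if "v * (1 + Q) = 1" for Q v :: "'a fps"
    proof -
      have "(1 - Q) * v * (1 - Q\<^sup>2) = (1 - Q)\<^sup>2 * (v * (1 + Q))"
        by (simp add: power2_eq_square algebra_simps)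
      then show ?thesis using that by simp
    qed
    from this [OF u [of "Suc n"]] have "(1 - fps_X ^ Suc n) * u (Suc n) * (1 - fps_X ^ (2 * Suc n)) = (1 - fps_X ^ Suc n)\<^sup>2"
      by (simp only: power_even_eq)
    ultimately have 1: "R (Suc n) 0 * (1 - fps_X ^ (2 * Suc n)) = R n 0 * (1 - fps_X ^ Suc n)\<^sup>2"
      by (simp only: mult.assoc)
    have 2: "r' * (b * y) = (a * x)\<^sup>2" if "r' * y = r * x\<^sup>2" "r * b = a\<^sup>2" for r r' a b x y :: "'a fps"
    proof -
      have "r' * (b * y) = (r' * y) * b" by (simp add: mult_ac)
      also have "\<dots> = (r * b) * x\<^sup>2" unfolding that(1) by (simp add: mult_ac)
      finally show ?thesis unfolding that(2) by (simp add: power_mult_distrib)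
    qed
    show ?case
      unfolding prod.lessThan_Suc by (rule 2 [OF _ Suc.IH]) (simp only: 1 flip: Suc_eq_plus1)
  qed
  then show "(\<lambda>n. R n 0 * (\<Prod>i<n. 1 - fps_X ^ (2 * (i + 1)))) \<longlonglongrightarrow> euler ^ 2"
    using tendsto_power_fps [OF tendsto_euler [where 'a='a], of 2] by simp
qed

lemma theta4_eq: "theta4 = euler_odd ^ 2 * fps_subst_power 2 (euler :: 'a::field fps)"
proof -
  have "fps_subst_power 2 (euler :: 'a fps) \<noteq> 0"
    by (rule fps_nonzeroI [of _ 0]) (simp add: fps_subst_power_nth)
  moreover have "theta4 * fps_subst_power 2 (euler :: 'a fps) =
      (euler_odd ^ 2 * fps_subst_power 2 euler) * fps_subst_power 2 euler"
    unfolding theta4_mult_euler by (subst euler_factor) (simp add: power2_eq_square mult_ac)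
  ultimately show ?thesis by simp
qed

text \<open>For odd \<open>k\<close>, replacing \<open>q\<close> by \<open>-q\<close> turns
  \<open>1 - q ^ k\<close> into \<open>1 + q ^ k\<close>.\<close>

lemma euler_odd_compose_minus:
  "euler_odd * (euler_odd oo (- fps_X)) = fps_subst_power 2 (euler_odd :: 'a::idom fps)"
proof (rule LIMSEQ_unique)
  let ?P = "\<lambda>N. \<Prod>i<N. 1 - fps_X ^ (2 * i + 1) :: 'a fps"
  have "(\<lambda>N. ?P N oo (- fps_X)) \<longlonglongrightarrow> (euler_odd oo (- fps_X))"
    using tendsto_euler_odd [where 'a='a] unfolding tendsto_fps_iff fps_compose_uminus'
    by (auto elim: eventually_mono)
  then show "(\<lambda>N. ?P N * (?P N oo (- fps_X))) \<longlonglongrightarrow> euler_odd * (euler_odd oo (- fps_X))"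
    by (intro tendsto_mult_fps tendsto_euler_odd)
  have "?P N * (?P N oo (- fps_X)) = fps_subst_power 2 (?P N)" for N
  proof -
    have "?P N oo (- fps_X) = (\<Prod>i<N. 1 + fps_X ^ (2 * i + 1))"
      by (simp add: fps_compose_prod_distrib fps_compose_sub_distrib del: power_Suc flip: fps_compose_power)
    moreover have "(1 - fps_X ^ k) * (1 + fps_X ^ k) = fps_subst_power 2 (1 - fps_X ^ k :: 'a fps)" for k
      by (simp add: algebra_simps flip: power_mult power_add)
    ultimately show ?thesis by (simp flip: prod.distrib del: power_Suc)
  qed
  then show "(\<lambda>N. ?P N * (?P N oo (- fps_X))) \<longlonglongrightarrow> fps_subst_power 2 euler_odd"
    by (simp only: tendsto_fps_subst_power tendsto_euler_odd)
qed

lemma theta3_eq: "theta3 = (euler_odd oo (- fps_X)) ^ 2 * fps_subst_power 2 (euler :: 'a::field fps)"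
proof -
  have "theta3 = theta4 oo (- fps_X :: 'a fps)"
    by (simp add: fps_eq_iff fps_compose_uminus' theta4_nth flip: power_mult_distrib mult.assoc)
  also have "\<dots> = (euler_odd oo (- fps_X)) ^ 2 * (fps_subst_power 2 euler oo (- fps_X))"
    by (simp add: theta4_eq fps_compose_mult_distrib fps_compose_power)
  also have "fps_subst_power 2 euler oo (- fps_X) = fps_subst_power 2 (euler :: 'a fps)"
    by (auto simp: fps_eq_iff fps_compose_uminus' fps_subst_power_nth)
  finally show ?thesis .
qed


text \<open>The geometric half of the mean step, read off from the two product formulas.\<close>

lemma theta3_mult_theta4: "theta3 * theta4 = fps_subst_power 2 (theta4 :: 'a::field fps) ^ 2"
proof -
  have "theta3 * theta4 = (euler_odd * (euler_odd oo (- fps_X)) * fps_subst_power 2 (euler :: 'a fps)) ^ 2"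
    by (simp add: theta3_eq theta4_eq power_mult_distrib power2_eq_square mult_ac)
  also have "\<dots> = fps_subst_power 2 (euler_odd * euler) ^ 2"
    by (simp add: euler_odd_compose_minus)
  also have "\<dots> = fps_subst_power 2 theta4 ^ 2"
    by (subst euler_factor) (simp add: theta4_eq power2_eq_square mult_ac)
  finally show ?thesis .
qed

subsection \<open>The arithmetic-geometric mean modulo 7\<close>

lemma f7_numeral_eq_1_iff: "(numeral m :: f7) = 1 \<longleftrightarrow> [numeral m = 1 :: int] (mod 7)"
  using of_int_f7_eq_iff [of "numeral m" 1] by simp

lemma f7_numeral_eq_0_iff: "(numeral m :: f7) = 0 \<longleftrightarrow> [numeral m = 0 :: int] (mod 7)"
  using of_int_f7_eq_iff [of "numeral m" 0] by simp

text \<open>The witnesses \<open>r\<close> used below come from expanding the difference of both sides over the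
  integers, where all coefficients turn out to be multiples of 7.\<close>

lemma fps_f7_eqI: "x = y + 7 * r \<Longrightarrow> x = (y :: f7 fps)"
  by (simp add: fps_f7_seven)

text \<open>\<open>y\<close> and \<open>z\<close> stand for the squares of \<open>theta3\<close> and
  \<open>theta4\<close>. The substitution yields their arithmetic mean for \<open>y\<close> and
  their geometric mean for \<open>z\<close>, squared here to avoid a root.\<close>

locale agm_mod_7 =
  fixes y z :: "f7 fps"
  assumes subst_y: "2 * fps_subst_power 2 y = y + z"
    and subst_z: "fps_subst_power 2 z ^ 2 = y * z"
    and y_nth: "fps_nth y 0 = 1" "fps_nth y 1 = 4"
    and z_nth: "fps_nth z 0 = 1" "fps_nth z 1 = -4"
begin

abbreviation D :: "f7 fps \<Rightarrow> f7 fps" where "D \<equiv> fps_subst_power 2"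
abbreviation Y :: "f7 fps" where "Y \<equiv> y ^ 2"
abbreviation Z :: "f7 fps" where "Z \<equiv> z ^ 2"

text \<open>Squaring the arithmetic mean brings in 1/4, which is 2 modulo 7.\<close>

lemma subst_Y: "D Y = 2 * (y + z) ^ 2"
proof (rule fps_f7_eqI)
  have "4 * D Y = (2 * D y) ^ 2" by (simp add: power_mult_distrib)
  then have "4 * D Y = (y + z) ^ 2" by (simp only: subst_y)
  then show "D Y = 2 * (y + z) ^ 2 + 7 * (- D Y)" by (simp add: algebra_simps) algebra
qed

lemma subst_Z: "D Z = y * z"
  using subst_z by simp

text \<open>Modulo 7 the mean step fixes the form \<open>?W\<close>, and so does the constant 1;
  their constant coefficients agree, hence they are equal.\<close>

lemma cubic: "- (Y ^ 3 + 2 * Y ^ 2 * Z + 2 * Y * Z ^ 2 + Z ^ 3) = 1"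
proof -
  let ?W = "- (Y ^ 3 + 2 * Y ^ 2 * Z + 2 * Y * Z ^ 2 + Z ^ 3)"
  have "D ?W = - (D Y ^ 3 + 2 * D Y ^ 2 * D Z + 2 * D Y * D Z ^ 2 + D Z ^ 3)"
    by simp
  also have "\<dots> = ?W"
    unfolding subst_Y subst_Z
    by (rule fps_f7_eqI [where r = "- 8 * y * z ^ 5 - 22 * y ^ 2 * z ^ 4 - 31 * y ^ 3 * z ^ 3
        - 22 * y ^ 4 * z ^ 2 - 8 * y ^ 5 * z - y ^ 6 - z ^ 6"]) algebra
  finally have "1 * (?W - 1) = 1 * D (?W - 1)" by simp
  \<comment> \<open>This coefficient is -7; the binary numeral in the instance is 7.\<close>
  moreover have "fps_nth (?W - 1) 0 = 0"
    using f7_numeral_eq_0_iff [of "num.Bit1 (num.Bit1 num.One)"] by (simp add: fps_nth_power_0 y_nth z_nth cong_def numeral_fps_const)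
  ultimately have "?W - 1 = 0"
    by (intro fps_subst_power_2_eq_0 [where v = 1 and u = 1 and n = 0]) auto
  then show ?thesis by simp
qed

section \<open>Logarithmic derivatives of \<open>y\<close> and \<open>z\<close>\<close>

definition s :: "f7 fps" where "s = inverse y * theta y"
definition t :: "f7 fps" where "t = inverse z * theta z"

lemma y_nonzero: "y \<noteq> 0" and z_nonzero: "z \<noteq> 0"
  using y_nth z_nth by auto

lemma theta_y: "theta y = y * s" and theta_z: "theta z = z * t"
  by (simp_all add: s_def t_def inverse_mult_eq_1' y_nth z_nth flip: mult.assoc)

lemma s_nth: "fps_nth s 0 = 0" "fps_nth s 1 = 4"
  and t_nth: "fps_nth t 0 = 0" "fps_nth t 1 = -4"
proof -
  have "fps_nth (theta y) n = fps_nth (y * s) n" "fps_nth (theta z) n = fps_nth (z * t) n" for n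
    by (simp_all only: theta_y theta_z)
  from this [of 0] this [of 1] show "fps_nth s 0 = 0" "fps_nth s 1 = 4" "fps_nth t 0 = 0" "fps_nth t 1 = -4"
    using y_nth z_nth by (simp_all add: theta_nth fps_mult_nth_1)
qed

text \<open>Apply \<open>theta\<close> to the arithmetic mean relation; moving \<open>theta\<close>
  past \<open>D\<close> costs a factor 2. The geometric mean gives \<open>subst_t\<close>
  likewise.\<close>

lemma subst_s: "2 * D s * (y + z) = y * s + z * t"
proof -
  have "theta (2 * D y) = 4 * (D y * D s)"
    by (simp add: theta_fps_subst_power theta_y)
  moreover have "theta (2 * D y) = y * s + z * t"
    unfolding subst_y by (simp add: theta_y theta_z)
  moreover have "4 * (D y * D s) = 2 * D s * (2 * D y)" by simp
  ultimately show ?thesis by (simp only: subst_y)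
qed

lemma subst_t: "4 * D t = s + t"
proof -
  have "theta (D z ^ 2) = D z ^ 2 * (4 * D t)"
    by (simp add: theta_power theta_fps_subst_power theta_z power2_eq_square)
  moreover have "theta (y * z) = (y * z) * (s + t)"
    by (simp add: theta_y theta_z algebra_simps)
  ultimately have "(y * z) * (4 * D t) = (y * z) * (s + t)"
    unfolding subst_z by simp
  then show ?thesis using y_nonzero z_nonzero by (simp only: mult_cancel_left) simp
qed

lemma subst_Y_minus_Z: "4 * D (Y - Z) = (y - z) ^ 2"
proof -
  have "4 * D (Y - Z) = 8 * (y + z) ^ 2 - 4 * (y * z)"
    unfolding fps_subst_power_simps(2) [OF pos2] subst_Y subst_Z by simp
  also have "\<dots> = (y - z) ^ 2"
    by (rule fps_f7_eqI [where r = "(y + z) ^ 2"]) algebra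
  finally show ?thesis .
qed

text \<open>The difference \<open>?f\<close> of the two sides satisfies a linear equation in
  \<open>?f\<close> and \<open>D ?f\<close>. Its leading factor \<open>y - z\<close> has order 1, so
  two vanishing coefficients suffice.\<close>

lemma two_t: "2 * t = 2 * s - (Y - Z)"
proof -
  let ?f = "2 * (s - t) - (Y - Z)"
  have "(y - z) * ?f = (4 * (y + z)) * D ?f"
  proof -
    have "(4 * (y + z)) * D ?f = 4 * (2 * D s * (y + z)) - 2 * (y + z) * (4 * D t) - (y + z) * (4 * D (Y - Z))"
      by (simp add: algebra_simps)
    then show ?thesis
      unfolding subst_s subst_t subst_Y_minus_Z by algebra
  qed
  moreover have "fps_nth (y - z) 1 \<noteq> 0"
    using y_nth z_nth by (simp add: f7_numeral_eq_0_iff cong_def)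
  moreover have "fps_nth ?f i = 0" if "i \<le> 1" for i
  proof -
    from that consider "i = 0" | "i = 1" by linarith
    then show ?thesis
      by cases (use y_nth z_nth s_nth t_nth in \<open>simp_all add: fps_nth_power_0 power2_eq_square fps_mult_nth_1 numeral_fps_const\<close>)
  qed
  ultimately have "?f = 0" by (rule fps_subst_power_2_eq_0)
  then show ?thesis by (simp add: algebra_simps)
qed

lemma theta_Y: "theta Y = 2 * Y * s" and theta_Z: "theta Z = Z * (2 * s - (Y - Z))"
proof -
  show "theta Y = 2 * Y * s" by (simp add: theta_power theta_y power2_eq_square)
  have "theta Z = Z * (2 * t)" by (simp add: theta_power theta_z power2_eq_square)
  then show "theta Z = Z * (2 * s - (Y - Z))" unfolding two_t .
qed

text \<open>\<open>theta\<close> kills the cubic form. As the form has degree 3 in \<open>Y\<close>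
  and \<open>Z\<close>, the rules for \<open>theta Y\<close> and \<open>theta Z\<close> yield
  \<open>6 * s\<close> times the form plus a polynomial; now 6 is -1 and the form is 1.\<close>

lemma s_eq: "s = (Y - Z) * Z * (2 * Y ^ 2 + 4 * Y * Z + 3 * Z ^ 2)"
proof -
  have id: "s' * (- (p ^ 3 + 2 * p ^ 2 * q + 2 * p * q ^ 2 + q ^ 3)) =
      (p - q) * q * (2 * p ^ 2 + 4 * p * q + 3 * q ^ 2)"
    if "3 * p ^ 2 * p' + 2 * (2 * p * p' * q + p ^ 2 * q') + 2 * (p' * q ^ 2 + p * (2 * q * q')) + 3 * q ^ 2 * q' = 0"
      "p' = 2 * p * s'" "q' = q * (2 * s' - (p - q))" for p q p' q' s' :: "f7 fps"
  proof (rule fps_f7_eqI [where r = "- 2 * p * q ^ 2 * s' - 2 * p ^ 2 * q * s' - p ^ 3 * s' - q ^ 3 * s'"])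
    show "s' * (- (p ^ 3 + 2 * p ^ 2 * q + 2 * p * q ^ 2 + q ^ 3)) =
      (p - q) * q * (2 * p ^ 2 + 4 * p * q + 3 * q ^ 2) +
      7 * (- 2 * p * q ^ 2 * s' - 2 * p ^ 2 * q * s' - p ^ 3 * s' - q ^ 3 * s')"
      using that(1) unfolding that(2,3) by algebra
  qed
  have "theta (- (Y ^ 3 + 2 * Y ^ 2 * Z + 2 * Y * Z ^ 2 + Z ^ 3)) = 0"
    unfolding cubic by simp
  moreover have "theta (- (p ^ 3 + 2 * p ^ 2 * q + 2 * p * q ^ 2 + q ^ 3)) = - (3 * p ^ 2 * theta p + 2 * (2 * p * theta p * q + p ^ 2 * theta q)
      + 2 * (theta p * q ^ 2 + p * (2 * q * theta q)) + 3 * q ^ 2 * theta q)" for p q :: "f7 fps"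
    by (simp add: theta_power algebra_simps)
  ultimately have "3 * Y ^ 2 * theta Y + 2 * (2 * Y * theta Y * Z + Y ^ 2 * theta Z)
      + 2 * (theta Y * Z ^ 2 + Y * (2 * Z * theta Z)) + 3 * Z ^ 2 * theta Z = 0"
    by (metis neg_equal_0_iff_equal)
  from id [OF this theta_Y theta_Z] show ?thesis by (simp only: cubic mult_1_right)
qed

section \<open>Differential equations in terms of a unit \<open>a\<close>\<close>

definition a :: "f7 fps" where "a = 2 * Y - Z"
text \<open>Modulo 7 the form in \<open>cubic\<close> splits into linear factors: \<open>a\<close>
  and those in \<open>b\<close>. Hence \<open>b\<close> is the inverse of \<open>a\<close>.\<close>

definition b :: "f7 fps" where "b = 4 * (Y + Z) * (2 * Z - Y)"
definition c :: "f7 fps" where "c = a ^ 3"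
text \<open>The factor 4 is 1/16 modulo 7 and makes the coefficient of \<open>q\<close> equal to
  1.\<close>

definition M :: "f7 fps" where "M = 4 * (Y - Z) * Y * Z"

text \<open>The functional equation by which \<open>theta_M_eq\<close> recognizes \<open>M\<close>
  as a product.\<close>

lemma M_square: "M ^ 2 = D M * (y * z) ^ 3"
proof -
  have "D M = 4 * D (Y - Z) * D Y * D Z"
    unfolding M_def by simp
  then have "D M = (y - z) ^ 2 * (2 * (y + z) ^ 2) * (y * z)"
    by (simp only: subst_Y_minus_Z subst_Y subst_Z)
  moreover have "M ^ 2 = (y - z) ^ 2 * (2 * (y + z) ^ 2) * (y * z) * (y * z) ^ 3"
    unfolding M_def by (rule fps_f7_eqI [where r = "2 * (Y - Z) ^ 2 * Y ^ 2 * Z ^ 2"]) algebra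
  ultimately show ?thesis by simp
qed

lemma M_nth: "fps_nth M 0 = 0" "fps_nth M 1 = 1"
  using y_nth z_nth
  by (simp_all add: M_def fps_mult_nth_1 power2_eq_square numeral_fps_const f7_numeral_eq_1_iff cong_def)

lemma a_mult_b: "a * b = 1"
proof -
  have "a * b = - (Y ^ 3 + 2 * Y ^ 2 * Z + 2 * Y * Z ^ 2 + Z ^ 3)"
    unfolding a_def b_def
    by (rule fps_f7_eqI [where r = "2 * Y * Z ^ 2 + 2 * Y ^ 2 * Z - Y ^ 3 - Z ^ 3"]) algebra
  then show ?thesis by (simp only: cubic)
qed

text \<open>Writing 1 as the cubic form makes \<open>c + 1\<close> homogeneous of degree 3, and it
  factors. With \<open>c_minus_1\<close> this later brings back the factors of
  \<open>M\<close>.\<close>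

lemma c_plus_1: "c + 1 = 2 * a * Z ^ 2"
proof -
  have "a ^ 3 + - (Y ^ 3 + 2 * Y ^ 2 * Z + 2 * Y * Z ^ 2 + Z ^ 3) = 2 * a * Z ^ 2"
    unfolding a_def by (rule fps_f7_eqI [where r = "- 2 * Y ^ 2 * Z + Y ^ 3"]) algebra
  then show ?thesis by (simp only: cubic c_def)
qed

lemma c_minus_1: "c - 1 = a * (Y - Z) * Y"
proof -
  have "a ^ 3 - - (Y ^ 3 + 2 * Y ^ 2 * Z + 2 * Y * Z ^ 2 + Z ^ 3) = a * (Y - Z) * Y"
    unfolding a_def by (rule fps_f7_eqI [where r = "Y * Z ^ 2 - Y ^ 2 * Z + Y ^ 3"]) algebra
  then show ?thesis by (simp only: cubic c_def)
qed

text \<open>Since \<open>b\<close> is \<open>1 / a\<close>, this is a differential equation for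
  \<open>a\<close> alone. The form \<open>?W\<close>, which is 1, is inserted to equalize degrees in
  \<open>Y\<close> and \<open>Z\<close>.\<close>

lemma theta_a: "theta a = b - a ^ 5"
proof -
  let ?W = "- (Y ^ 3 + 2 * Y ^ 2 * Z + 2 * Y * Z ^ 2 + Z ^ 3)"
  let ?s = "(Y - Z) * Z * (2 * Y ^ 2 + 4 * Y * Z + 3 * Z ^ 2)"
  have "theta a = 2 * theta Y - theta Z" unfolding a_def theta_simps by simp
  also have "\<dots> = 2 * ?s * a + (Y - Z) * Z * ?W"
    unfolding theta_Y theta_Z cubic s_eq [symmetric] a_def by algebra
  also have "\<dots> = b * ?W - a ^ 5"
    unfolding a_def b_def
    by (rule fps_f7_eqI [where r = "3 * Y * Z ^ 4 - 4 * Y ^ 2 * Z ^ 3 + 13 * Y ^ 3 * Z ^ 2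
        - 11 * Y ^ 4 * Z + 4 * Y ^ 5 + 2 * Z ^ 5"]) algebra
  finally show ?thesis by (simp only: cubic mult_1_right)
qed

lemma theta_M: "theta M = M * (6 * s - Y + 2 * Z)"
proof -
  have "theta M = 4 * ((theta Y - theta Z) * Y * Z + (Y - Z) * theta Y * Z + (Y - Z) * Y * theta Z)"
    unfolding M_def theta_simps by algebra
  then show ?thesis unfolding theta_Y theta_Z M_def by algebra
qed

lemma theta_z_M2: "theta (z * M ^ 2) = z * M ^ 2 * (4 * a ^ 4 + 3 * a + 2 * b ^ 2)"
proof -
  let ?W = "- (Y ^ 3 + 2 * Y ^ 2 * Z + 2 * Y * Z ^ 2 + Z ^ 3)"
  let ?s = "(Y - Z) * Z * (2 * Y ^ 2 + 4 * Y * Z + 3 * Z ^ 2)"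
  have "theta (z * M ^ 2) = z * M ^ 2 * (t + 2 * (6 * s - Y + 2 * Z))"
    by (simp add: theta_z theta_M theta_power power2_eq_square algebra_simps)
  \<comment> \<open>As 8 is 1 modulo 7, \<open>t\<close> is \<open>4 * (2 * t)\<close>, to which
    \<open>two_t\<close> applies.\<close>
  also have "t + 2 * (6 * s - Y + 2 * Z) = 4 * (2 * t) + 2 * (6 * s - Y + 2 * Z)"
    by (rule fps_f7_eqI [where r = "- t"]) algebra
  also have "\<dots> = 20 * ?s + (- 6 * Y + 8 * Z) * ?W"
    unfolding two_t cubic s_eq [symmetric] by algebra
  also have "\<dots> = 4 * a ^ 4 + 3 * a * ?W + 2 * b ^ 2"
    unfolding a_def b_def
    by (rule fps_f7_eqI [where r = "- 18 * Y * Z ^ 3 + 6 * Y ^ 2 * Z ^ 2 + 35 * Y ^ 3 * Z - 12 * Y ^ 4 - 29 * Z ^ 4"]) algebra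
  finally show ?thesis by (simp only: cubic mult_1_right)
qed

text \<open>All derivatives of \<open>z * M ^ 2\<close> are \<open>z * M ^ 2\<close> times a Laurent polynomial in \<open>a\<close>, which
  is homogeneous modulo 3: up to a power of \<open>b = 1 / a\<close>, it is a polynomial in \<open>c = a ^ 3\<close>.\<close>

definition e :: "f7 fps" where "e = b ^ 2"

lemma theta_c: "theta c = e * (3 * c * (1 - c ^ 2))"
proof -
  have "theta c = 3 * a ^ 2 * (b - a ^ 5)"
    unfolding c_def by (simp add: theta_power theta_a)
  also have "\<dots> = e * (3 * c * (1 - c ^ 2))"
    using a_mult_b unfolding e_def c_def by algebra
  finally show ?thesis .
qed

lemma theta_e: "theta e = - 2 * e ^ 2 * (1 - c ^ 2)"
proof -
  have "theta (a * b) = 0" unfolding a_mult_b by simp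
  then have "(b - a ^ 5) * b + a * theta b = 0" by (simp only: theta_simps theta_a)
  then have "theta b = - (b ^ 3 * (1 - c ^ 2))"
    using a_mult_b unfolding c_def by algebra
  moreover have "theta e = 2 * b * theta b" unfolding e_def by (simp add: theta_power)
  ultimately show ?thesis unfolding e_def by algebra
qed

lemma theta_z_M2_c: "theta (z * M ^ 2) = z * M ^ 2 * (e * (4 * c ^ 2 + 3 * c + 2))"
proof -
  have "4 * a ^ 4 + 3 * a + 2 * b ^ 2 = e * (4 * c ^ 2 + 3 * c + 2)"
    using a_mult_b unfolding e_def c_def by algebra
  then show ?thesis by (simp only: theta_z_M2)
qed

text \<open>Product and chain rule: for a polynomial \<open>q\<close> in \<open>c\<close>,
  \<open>q'\<close> is its derivative with respect to \<open>c\<close>. Each application adds one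
  power of \<open>e\<close>, so only polynomials in \<open>c\<close> need tracking.\<close>

lemma theta_step:
  assumes "theta q = e * (3 * c * (1 - c ^ 2) * q')"
  shows "theta (z * M ^ 2 * e ^ k * q) = z * M ^ 2 * e ^ Suc k *
    (q * (4 * c ^ 2 + 3 * c + 2 - 2 * of_nat k * (1 - c ^ 2)) + 3 * c * (1 - c ^ 2) * q')"
proof -
  have ek: "theta (e ^ k) = - 2 * of_nat k * e ^ Suc k * (1 - c ^ 2)"
  proof (induction k)
    case (Suc k)
    show ?case unfolding power_Suc theta_simps(7) theta_e Suc.IH of_nat_Suc by algebra
  qed simp
  have "theta (z * M ^ 2 * e ^ k * q) =
      theta (z * M ^ 2) * e ^ k * q + z * M ^ 2 * theta (e ^ k) * q + z * M ^ 2 * e ^ k * theta q"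
    by (simp only: theta_simps(7)) (simp add: algebra_simps)
  then show ?thesis
    unfolding ek assms theta_z_M2_c by (simp add: algebra_simps)
qed

lemma theta_iterate_6: "(theta ^^ 6) (z * M ^ 2) = z * M ^ 2 + (z * M) ^ 7"
proof -
  let ?g = "z * M ^ 2"
  \<comment> \<open>\<open>?q1\<close> to \<open>?q6\<close> result from repeating
    \<open>theta_step\<close>, with coefficients reduced to 0..6.\<close>
  let ?q1 = "2 + c * (3 + c * 4)"
  let ?q2 = "c * (1 + c * 3)"
  let ?q3 = "c * (1 + c * (1 + c * c * 6))"
  let ?q4 = "c * (6 + c * (5 + c * (3 + c * (3 + c * (4 + c * 2)))))"
  let ?q5 = "c * (3 + c * (4 + c * (1 + c * (1 + c * (5 + c * (1 + c * (1 + c * 2)))))))"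
  let ?q6 = "c * (6 + c * (1 + c * (4 + c * (4 + c * (1 + c * (6 + c * (4 + c * (3 + c * (6 + c)))))))))"
  have step: "theta (?g * e ^ k * q) = ?g * e ^ k1 * q''"
    if "theta q = e * (3 * c * (1 - c ^ 2) * q')"
      "q * (4 * c ^ 2 + 3 * c + 2 - 2 * m * (1 - c ^ 2)) + 3 * c * (1 - c ^ 2) * q' = q'' + 7 * r"
      "m = of_nat k" "k1 = Suc k" for k k1 m q q' q'' r
    using theta_step [OF that(1), of k] fps_f7_eqI [OF that(2)] that(3,4) by (simp only:)
  have 1: "theta ?g = ?g * e ^ 1 * ?q1"
    unfolding theta_z_M2_c by algebra
  have 2: "theta (?g * e ^ 1 * ?q1) = ?g * e ^ 2 * ?q2"
  proof (rule step)
    show "theta ?q1 = e * (3 * c * (1 - c ^ 2) * (3 + 8 * c))"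
      unfolding theta_simps theta_c by algebra
    show "?q1 * (4 * c ^ 2 + 3 * c + 2 - 2 * 1 * (1 - c ^ 2)) + 3 * c * (1 - c ^ 2) * (3 + 8 * c) =
        ?q2 + 7 * (2 * c + 6 * c ^ 2 + 3 * c ^ 3)"
      by algebra
  qed simp_all
  have 3: "theta (?g * e ^ 2 * ?q2) = ?g * e ^ 3 * ?q3"
  proof (rule step)
    show "theta ?q2 = e * (3 * c * (1 - c ^ 2) * (1 + 6 * c))"
      unfolding theta_simps theta_c by algebra
    show "?q2 * (4 * c ^ 2 + 3 * c + 2 - 2 * 2 * (1 - c ^ 2)) + 3 * c * (1 - c ^ 2) * (1 + 6 * c) =
        ?q3 + 7 * (2 * c ^ 2 + 2 * c ^ 3)"
      by algebra
  qed simp_all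
  have 4: "theta (?g * e ^ 3 * ?q3) = ?g * e ^ 4 * ?q4"
  proof (rule step)
    show "theta ?q3 = e * (3 * c * (1 - c ^ 2) * (1 + 2 * c + 24 * c ^ 3))"
      unfolding theta_simps theta_c by algebra
    show "?q3 * (4 * c ^ 2 + 3 * c + 2 - 2 * 3 * (1 - c ^ 2)) + 3 * c * (1 - c ^ 2) * (1 + 2 * c + 24 * c ^ 3) =
        ?q4 + 7 * (- c + c ^ 3 + 7 * c ^ 4 + 2 * c ^ 5 - 2 * c ^ 6)"
      by algebra
  qed simp_all
  have 5: "theta (?g * e ^ 4 * ?q4) = ?g * e ^ 5 * ?q5"
  proof (rule step)
    show "theta ?q4 = e * (3 * c * (1 - c ^ 2) * (6 + 10 * c + 9 * c ^ 2 + 12 * c ^ 3 + 20 * c ^ 4 + 12 * c ^ 5))"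
      unfolding theta_simps theta_c by algebra
    show "?q4 * (4 * c ^ 2 + 3 * c + 2 - 2 * 4 * (1 - c ^ 2)) + 3 * c * (1 - c ^ 2) * (6 + 10 * c + 9 * c ^ 2 + 12 * c ^ 3 + 20 * c ^ 4 + 12 * c ^ 5) =
        ?q5 + 7 * (- 3 * c + 2 * c ^ 2 + 11 * c ^ 3 + 8 * c ^ 4 + 7 * c ^ 5 + 5 * c ^ 6 - c ^ 7 - 2 * c ^ 8)"
      by algebra
  qed simp_all
  have 6: "theta (?g * e ^ 5 * ?q5) = ?g * e ^ 6 * ?q6"
  proof (rule step)
    show "theta ?q5 = e * (3 * c * (1 - c ^ 2) * (3 + 8 * c + 3 * c ^ 2 + 4 * c ^ 3 + 25 * c ^ 4 + 6 * c ^ 5 + 7 * c ^ 6 + 16 * c ^ 7))"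
      unfolding theta_simps theta_c by algebra
    show "?q5 * (4 * c ^ 2 + 3 * c + 2 - 2 * 5 * (1 - c ^ 2)) + 3 * c * (1 - c ^ 2) * (3 + 8 * c + 3 * c ^ 2 + 4 * c ^ 3 + 25 * c ^ 4 + 6 * c ^ 5 + 7 * c ^ 6 + 16 * c ^ 7) =
        ?q6 + 7 * (- 3 * c + 6 * c ^ 3 + 5 * c ^ 4 + 6 * c ^ 5 + 3 * c ^ 6 + c ^ 7 + 4 * c ^ 8 - c ^ 9 - 3 * c ^ 10)"
      by algebra
  qed simp_all
  have funpow_6: "(f ^^ 6) x = f (f (f (f (f (f x)))))" for f :: "f7 fps \<Rightarrow> f7 fps" and x
    by (simp add: eval_nat_numeral)
  have "(theta ^^ 6) ?g = ?g * e ^ 6 * ?q6"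
    unfolding funpow_6 1 2 3 4 5 6 ..
  \<comment> \<open>\<open>e ^ 6 * c ^ 4\<close> is \<open>(a * b) ^ 12\<close>, that is 1, and
    returns \<open>?g\<close>; the other summand supplies the seventh power through
    \<open>c_plus_1\<close> and \<open>c_minus_1\<close>.\<close>
  also have "?q6 = c ^ 4 + c * (c + 1) ^ 4 * (c - 1) ^ 5"
    by (rule fps_f7_eqI [where r = "c + c ^ 4 + c ^ 5 + c ^ 8 + c ^ 9"]) algebra
  also have "?g * e ^ 6 * \<dots> = ?g * ((a * b) ^ 12 + (a * b) ^ 12 * (16 * Z ^ 8 * (Y - Z) ^ 5 * Y ^ 5))"
    unfolding c_plus_1 c_minus_1 unfolding e_def c_def by algebra
  also have "\<dots> = ?g + (z * M) ^ 7"
  proof -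
    have "(z * M) ^ 7 = ?g * (Z ^ 3 * (4 * (Y - Z) * Y * Z) ^ 5)"
      unfolding M_def by algebra
    also have "Z ^ 3 * (4 * (Y - Z) * Y * Z) ^ 5 = 16 * Z ^ 8 * (Y - Z) ^ 5 * Y ^ 5"
      by (rule fps_f7_eqI [where r = "144 * Z ^ 8 * (Y - Z) ^ 5 * Y ^ 5"]) (simp only: power_mult_distrib, algebra)
    finally show ?thesis unfolding a_mult_b by (simp add: algebra_simps)
  qed
  finally show ?thesis .
qed

end

section \<open>The theta series as an instance of the mean step\<close>

lemma theta3_theta4_squares:
  "2 * fps_subst_power 2 (theta3 ^ 2) = theta3 ^ 2 + (theta4 :: f7 fps) ^ 2"
proof -
  let ?D = "fps_subst_power 2 :: f7 fps \<Rightarrow> f7 fps"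
  \<comment> \<open>The defect of the claim. Squaring \<open>theta3_plus_theta4\<close> shows that
    it is -2 times its own image under \<open>?D\<close>, so it vanishes.\<close>
  let ?e = "theta3 ^ 2 + theta4 ^ 2 - 2 * ?D (theta3 ^ 2)"
  have "(theta3 + theta4) ^ 2 = (2 * ?D (?D theta3)) ^ 2"
    by (simp add: theta3_plus_theta4 fps_subst_power_fps_subst_power)
  then have "theta3 ^ 2 + theta4 ^ 2 + 2 * ?D theta4 ^ 2 = 4 * ?D (?D theta3) ^ 2"
    unfolding theta3_mult_theta4 [symmetric] by algebra
  then have "1 * ?e = - 2 * ?D ?e"
    by (simp add: algebra_simps)
  moreover have "fps_nth ?e i = 0" if "i \<le> 0" for i
    using that by (simp add: fps_nth_power_0 fps_subst_power_nth numeral_fps_const theta4_nth theta3_def)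
  moreover have "fps_nth 1 0 \<noteq> (0 :: f7)" by simp
  ultimately have "?e = 0" by (intro fps_subst_power_2_eq_0)
  then show ?thesis by simp
qed

interpretation theta: agm_mod_7 "theta3 ^ 2" "theta4 ^ 2"
proof
  show "2 * fps_subst_power 2 (theta3 ^ 2) = theta3 ^ 2 + (theta4 :: f7 fps) ^ 2"
    by (rule theta3_theta4_squares)
  show "fps_subst_power 2 (theta4 ^ 2 :: f7 fps) ^ 2 = theta3 ^ 2 * theta4 ^ 2"
    by (simp add: theta3_mult_theta4 flip: power_mult_distrib)
  show "fps_nth (theta3 ^ 2 :: f7 fps) 0 = 1" "fps_nth (theta4 ^ 2 :: f7 fps) 0 = 1"
    by (simp_all add: fps_nth_power_0 theta4_nth theta3_def)
  have "is_square (1 :: nat)" by simp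
  then show "fps_nth (theta3 ^ 2 :: f7 fps) 1 = 4" "fps_nth (theta4 ^ 2 :: f7 fps) 1 = - 4"
    by (simp_all add: power2_eq_square fps_mult_nth_1 theta4_nth theta3_def)
qed

text \<open>Both sides satisfy the quadratic equation \<open>M_square\<close>. Subtracting makes it
  linear in their difference, with leading factor their sum, whose coefficient of \<open>q\<close>
  is 2.\<close>

lemma theta_M_eq: "theta.M = fps_X * fps_subst_power 2 euler ^ 12"
proof -
  let ?D = "fps_subst_power 2 :: f7 fps \<Rightarrow> f7 fps"
  let ?y = "theta3 ^ 2 :: f7 fps" and ?z = "theta4 ^ 2 :: f7 fps"
  let ?N = "fps_X * ?D euler ^ 12"
  have "?N ^ 2 = ?D ?N * (?y * ?z) ^ 3"
  proof -
    have "?D theta4 * ?D (?D euler) = ?D (euler ^ 2)"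
      by (simp flip: theta4_mult_euler)
    then have "?D euler ^ 2 = ?D theta4 * ?D (?D euler)" by simp
    moreover have "?y * ?z = ?D theta4 ^ 4"
      unfolding power_mult_distrib [symmetric] theta3_mult_theta4 by simp
    moreover have "?D ?N = fps_X ^ 2 * ?D (?D euler) ^ 12" by simp
    ultimately show ?thesis by algebra
  qed
  with theta.M_square have "(theta.M + ?N) * (theta.M - ?N) = (?y * ?z) ^ 3 * ?D (theta.M - ?N)"
    unfolding fps_subst_power_simps(2) [OF pos2] by algebra
  moreover have N_nth: "fps_nth ?N 0 = 0" "fps_nth ?N 1 = 1"
    by (simp_all add: fps_mult_nth_1 fps_nth_power_0 fps_subst_power_nth)
  have "fps_nth (theta.M + ?N) 1 \<noteq> 0"
    unfolding fps_add_nth theta.M_nth N_nth by (simp add: f7_numeral_eq_0_iff cong_def)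
  moreover have "fps_nth (theta.M - ?N) i = 0" if "i \<le> 1" for i
  proof -
    from that consider "i = 0" | "i = 1" by linarith
    then show ?thesis
      by cases (simp_all only: fps_sub_nth theta.M_nth N_nth diff_self)
  qed
  ultimately have "theta.M - ?N = 0" by (rule fps_subst_power_2_eq_0)
  then show ?thesis by simp
qed

subsection \<open>The generating function modulo 7\<close>

text \<open>Mapping into \<open>rat\<close> is injective and returns the product identity to the
  integers; mapping into \<open>f7\<close> is reduction modulo 7.\<close>

definition fps_of_int :: "int fps \<Rightarrow> 'a::idom fps" where
  "fps_of_int f = Abs_fps (\<lambda>n. of_int (fps_nth f n))"

lemma fps_of_int_nth [simp]: "fps_nth (fps_of_int f) n = of_int (fps_nth f n)"
  by (simp add: fps_of_int_def)

lemma fps_of_int_simps [simp]: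
  "fps_of_int 1 = 1"
  "fps_of_int fps_X = fps_X"
  "fps_of_int (f - g) = fps_of_int f - fps_of_int g"
  "fps_of_int (f * g) = fps_of_int f * fps_of_int g"
  by (simp_all add: fps_eq_iff fps_mult_nth fps_X_def)

lemma fps_of_int_power [simp]: "fps_of_int (f ^ k) = fps_of_int f ^ k"
  by (induction k) simp_all

lemma fps_of_int_prod: "fps_of_int (\<Prod>i\<in>A. f i) = (\<Prod>i\<in>A. fps_of_int (f i))"
  by (induction A rule: infinite_finite_induct) simp_all

lemma fps_of_int_euler [simp]: "fps_of_int euler = euler"
proof (rule fps_ext)
  fix n
  have "fps_nth (fps_of_int euler) n = fps_nth (fps_of_int (\<Prod>i<Suc n. 1 - fps_X ^ (i + 1)) :: 'a fps) n"
    by (simp only: fps_of_int_nth euler_def fps_nth_Abs_fps)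
  then show "fps_nth (fps_of_int euler) n = fps_nth (euler :: 'a fps) n"
    by (simp only: fps_of_int_prod fps_of_int_simps fps_of_int_power euler_def fps_nth_Abs_fps)
qed

lemma fps_of_int_subst_power [simp]:
  "m > 0 \<Longrightarrow> fps_of_int (fps_subst_power m f) = fps_subst_power m (fps_of_int f)"
  by (simp add: fps_eq_iff fps_subst_power_nth)

lemma fps_of_int_rat_inj: "fps_of_int f = (fps_of_int g :: rat fps) \<Longrightarrow> f = g"
  by (simp add: fps_eq_iff)

text \<open>Denominators are cleared in the finite products over the rationals, before passing to
  the limit.\<close>

lemma broken_diamond_3_euler:
  "Abs_fps (broken_diamond 3) * euler ^ 3 * fps_subst_power 14 euler =
     fps_subst_power 2 euler * fps_subst_power 7 euler"
proof -
  let ?F = "\<lambda>N. \<Prod>i<N. broken_diamond_factor 3 (i + 1)"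
  let ?E = "\<lambda>m N. \<Prod>i<N. 1 - fps_X ^ (m * (i + 1)) :: rat fps"
  have F: "?F \<longlonglongrightarrow> Abs_fps (\<lambda>n. rat_of_int (broken_diamond 3 n))"
    by (rule has_prod_imp_tendsto' [OF broken_diamond_gf])
  have "?F N * ?E 1 N ^ 3 * ?E 14 N = ?E 2 N * ?E 7 N" for N
  proof -
    have "broken_diamond_factor 3 n * (1 - fps_X ^ n) ^ 3 * (1 - fps_X ^ (14 * n)) =
        (1 - fps_X ^ (2 * n)) * (1 - fps_X ^ (7 * n))" if "n > 0" for n
    proof -
      let ?d = "(1 - fps_X ^ n) ^ 3 * (1 - fps_X ^ (14 * n)) :: rat fps"
      have "inverse ?d * ?d = 1"
        using that by (intro inverse_mult_eq_1) (simp add: fps_nth_power_0 power_0_left)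
      then show ?thesis
        using broken_diamond_factor_altdef [OF that, of 3] by (simp add: mult.assoc)
    qed
    then have "(\<Prod>i<N. broken_diamond_factor 3 (i + 1) * (1 - fps_X ^ (1 * (i + 1))) ^ 3 * (1 - fps_X ^ (14 * (i + 1)))) =
      (\<Prod>i<N. (1 - fps_X ^ (2 * (i + 1))) * (1 - fps_X ^ (7 * (i + 1))))"
      by (intro prod.cong) (simp_all only: mult_1)
    then show ?thesis by (simp only: prod.distrib prod_power_distrib)
  qed
  moreover have E1: "?E 1 \<longlonglongrightarrow> euler"
    using tendsto_euler_subst [of 1, where 'a=rat] by (simp add: fps_subst_power_def)
  have "(\<lambda>N. ?F N * ?E 1 N ^ 3 * ?E 14 N) \<longlonglongrightarrow>
      Abs_fps (\<lambda>n. rat_of_int (broken_diamond 3 n)) * euler ^ 3 * fps_subst_power 14 euler"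
    by (intro tendsto_mult_fps tendsto_power_fps F E1 tendsto_euler_subst) simp
  moreover have "(\<lambda>N. ?E 2 N * ?E 7 N) \<longlonglongrightarrow> fps_subst_power 2 euler * fps_subst_power 7 euler"
    by (intro tendsto_mult_fps tendsto_euler_subst) simp_all
  ultimately have "Abs_fps (\<lambda>n. rat_of_int (broken_diamond 3 n)) * euler ^ 3 * fps_subst_power 14 euler =
      fps_subst_power 2 euler * fps_subst_power 7 euler"
    by (simp only: LIMSEQ_unique)
  moreover have "Abs_fps (\<lambda>n. rat_of_int (broken_diamond 3 n)) = fps_of_int (Abs_fps (broken_diamond 3))"
    by (simp add: fps_of_int_def)
  ultimately show ?thesis
    by (intro fps_of_int_rat_inj) simp
qed

text \<open>Only multiples of \<open>m\<close> contribute to the convolution, so a series in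
  \<open>q ^ m\<close> can be pulled out of a section.\<close>

lemma fps_nth_mult_subst_power:
  assumes "m > 0"
  shows "fps_nth (f * fps_subst_power m p) (m * n) = fps_nth (Abs_fps (\<lambda>k. fps_nth f (m * k)) * p) n"
proof -
  have "fps_nth (f * fps_subst_power m p) (m * n) =
      (\<Sum>j\<le>m * n. fps_nth (fps_subst_power m p) j * fps_nth f (m * n - j))"
    by (simp add: mult.commute [of f] fps_mult_nth atLeast0AtMost)
  also have "\<dots> = (\<Sum>j\<in>(*) m ` {..n}. fps_nth (fps_subst_power m p) j * fps_nth f (m * n - j))"
    using assms by (intro sum.mono_neutral_right) (auto simp: fps_subst_power_nth elim!: dvdE)
  also have "\<dots> = (\<Sum>j\<le>n. fps_nth p j * fps_nth f (m * (n - j)))"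
    using assms by (subst sum.reindex) (auto simp: inj_on_def fps_subst_power_nth diff_mult_distrib2)
  also have "\<dots> = fps_nth (Abs_fps (\<lambda>k. fps_nth f (m * k)) * p) n"
    by (simp add: mult.commute [of "Abs_fps _"] fps_mult_nth atLeast0AtMost)
  finally show ?thesis .
qed

text \<open>By Frobenius the series in \<open>q ^ 7\<close> and \<open>q ^ 14\<close> become seventh
  powers, and common factors cancel.\<close>

lemma broken_diamond_3_f7:
  "fps_of_int (Abs_fps (broken_diamond 3)) * fps_subst_power 2 euler ^ 6 = (euler :: f7 fps) ^ 4"
proof -
  let ?E1 = "euler :: f7 fps" and ?E2 = "fps_subst_power 2 euler :: f7 fps"
  let ?B = "fps_of_int (Abs_fps (broken_diamond 3)) :: f7 fps"
  have nz: "?E1 \<noteq> 0" "?E2 \<noteq> 0"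
    by (auto intro!: fps_nonzeroI [of _ 0] simp: fps_subst_power_nth)
  have "fps_subst_power 14 ?E1 = fps_subst_power 7 ?E2"
    by (simp add: fps_subst_power_fps_subst_power)
  moreover have "fps_of_int (Abs_fps (broken_diamond 3) * euler ^ 3 * fps_subst_power 14 euler) =
     (fps_of_int (fps_subst_power 2 euler * fps_subst_power 7 euler) :: f7 fps)"
    by (simp only: broken_diamond_3_euler)
  ultimately have "?B * ?E1 ^ 3 * ?E2 ^ 7 = ?E2 * ?E1 ^ 7"
    by (simp add: fps_f7_power_7)
  then have "(?E1 ^ 3 * ?E2) * (?B * ?E2 ^ 6) = (?E1 ^ 3 * ?E2) * ?E1 ^ 4"
    by algebra
  then show ?thesis using nz by simp
qed

lemma broken_diamond_3_section:
  "of_int (broken_diamond 3 (7 * n + 5)) = - fps_nth ((euler :: f7 fps) ^ 4 * fps_subst_power 2 euler ^ 6) n"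
proof -
  let ?E1 = "euler :: f7 fps" and ?E2 = "fps_subst_power 2 euler :: f7 fps"
  let ?B = "fps_of_int (Abs_fps (broken_diamond 3)) :: f7 fps"
  let ?z = "theta4 ^ 2 :: f7 fps"
  let ?g = "?z * theta.M ^ 2"
  \<comment> \<open>The shift by \<open>fps_X ^ 2\<close> moves index \<open>7 * n + 5\<close> to
    \<open>7 * (n + 1)\<close>.\<close>
  let ?U = "Abs_fps (\<lambda>k. fps_nth (fps_X ^ 2 * ?B) (7 * k))"
  have E2: "?E2 \<noteq> 0"
    by (auto intro!: fps_nonzeroI [of _ 0] simp: fps_subst_power_nth)
  have z: "?z * ?E2 ^ 2 = ?E1 ^ 4"
    unfolding power_mult_distrib [symmetric] theta4_mult_euler by simp
  have g: "?g = fps_X ^ 2 * ?B * fps_subst_power 7 (?E2 ^ 4)"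
  proof -
    \<comment> \<open>Two of the 24 factors \<open>?E2\<close> in the square of \<open>M\<close>
      turn \<open>?z\<close> into \<open>?E1 ^ 4\<close>. The other 22 and the 6 from
      \<open>broken_diamond_3_f7\<close> make 28, a multiple of 7.\<close>
    have "?g = fps_X ^ 2 * (?z * ?E2 ^ 2) * ?E2 ^ 22"
      unfolding theta_M_eq by algebra
    also have "\<dots> = fps_X ^ 2 * ?B * (?E2 ^ 4) ^ 7"
      unfolding z broken_diamond_3_f7 [symmetric] by algebra
    finally show ?thesis by (simp only: fps_f7_power_7)
  qed
  have zM: "?z * theta.M = fps_X * ?E1 ^ 4 * ?E2 ^ 6 * ?E2 ^ 4"
    unfolding theta_M_eq z [symmetric] by algebra
  have "fps_nth ((theta ^^ k) f) m = of_nat m ^ k * fps_nth f m" for k m and f :: "f7 fps"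
    by (induction k) (simp_all add: theta_nth mult_ac)
  from this [of 6 ?g "7 * k" for k] have "fps_nth ((theta ^^ 6) ?g) (7 * k) = 0" for k
    by (simp add: f7_seven)
  then have "fps_nth ?g (7 * k) = - fps_nth (fps_subst_power 7 (?z * theta.M)) (7 * k)" for k
    unfolding theta.theta_iterate_6 fps_f7_power_7 by (simp add: eq_neg_iff_add_eq_0)
  then have "fps_nth (?U * ?E2 ^ 4) k = - fps_nth (?z * theta.M) k" for k
    unfolding g by (subst (asm) fps_nth_mult_subst_power) (simp_all only: fps_subst_power_nth, simp_all)
  then have "?U * ?E2 ^ 4 = - (?z * theta.M)"
    by (simp add: fps_eq_iff)
  then have "?U * ?E2 ^ 4 = - (fps_X * (?E1 ^ 4 * ?E2 ^ 6)) * ?E2 ^ 4"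
    unfolding zM by algebra
  then have "?U = - (fps_X * (?E1 ^ 4 * ?E2 ^ 6))"
    using E2 by (simp only: mult_cancel_right) simp
  then have "fps_nth ?U (n + 1) = - fps_nth (fps_X * (?E1 ^ 4 * ?E2 ^ 6)) (n + 1)"
    by (simp only: fps_neg_nth)
  then show ?thesis
    by (simp add: fps_X_power_mult_nth add.commute)
qed

theorem theorem1p1:
  shows "fps_cong
    (\<Prod>n. (1 - fps_X ^ (n + 1)) ^ 4 * (1 - fps_X ^ (2 * (n + 1))) ^ 6)
    (6 * Abs_fps (\<lambda>n. broken_diamond 3 (7 * n + 5)))
    7"
proof -
  let ?f = "\<lambda>n. (1 - fps_X ^ (n + 1)) ^ 4 * (1 - fps_X ^ (2 * (n + 1))) ^ 6 :: int fps"
  let ?P = "euler ^ 4 * fps_subst_power 2 euler ^ 6 :: int fps"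
  have "(\<lambda>N. (\<Prod>i<N. 1 - fps_X ^ (i + 1)) ^ 4 * (\<Prod>i<N. 1 - fps_X ^ (2 * (i + 1))) ^ 6) \<longlonglongrightarrow> ?P"
    by (intro tendsto_mult_fps tendsto_power_fps tendsto_euler tendsto_euler_subst) simp
  then have "(\<lambda>N. \<Prod>i<N. ?f i) \<longlonglongrightarrow> ?P"
    by (simp only: prod.distrib prod_power_distrib)
  then have "(\<lambda>N. \<Prod>i\<le>N. ?f i) \<longlonglongrightarrow> ?P"
    using LIMSEQ_lessThan_iff_atMost by blast
  moreover have "?P \<noteq> 0"
    by (rule fps_nonzeroI [of _ 0]) (simp add: fps_nth_power_0 fps_subst_power_nth)
  ultimately have "?f has_prod ?P"
    unfolding has_prod_def raw_has_prod_def by simp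
  then have P: "(\<Prod>n. ?f n) = ?P" by (rule has_prod_unique [symmetric])
  have "[fps_nth ?P n = fps_nth (6 * Abs_fps (\<lambda>n. broken_diamond 3 (7 * n + 5))) n] (mod 7)" for n
  proof -
    let ?p = "fps_nth ((euler :: f7 fps) ^ 4 * fps_subst_power 2 euler ^ 6) n"
    have "of_int (fps_nth ?P n) = fps_nth (fps_of_int ?P :: f7 fps) n" by (simp only: fps_of_int_nth)
    also have "\<dots> = ?p" by simp
    \<comment> \<open>As 6 is -1 modulo 7, it absorbs the sign in
      \<open>broken_diamond_3_section\<close>.\<close>
    also have "\<dots> = 6 * - ?p"
    proof -
      have "x - 6 * - x = 7 * x" for x :: f7 by simp
      then show ?thesis by (simp only: f7_seven mult_zero_left right_minus_eq)
    qed
    also have "\<dots> = of_int (fps_nth (6 * Abs_fps (\<lambda>n. broken_diamond 3 (7 * n + 5))) n)"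
      by (simp add: numeral_fps_const broken_diamond_3_section)
    finally show ?thesis by (simp only: of_int_f7_eq_iff)
  qed
  then show ?thesis unfolding fps_cong_def P by blast
qed

end
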